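(* Let $(G,\tau)$ be a topological abelian group and $\phi:(G,\tau)\to(G,\tau)$ a continuous endomorphism. Let $G^1_\tau=\bigcap_{N\in\mathcal C_\tau(G)}N$, let $\tau_q$ be the quotient topology induced by $\tau$ on $G/G^1_\tau$, and let $\phi^1_\tau:(G/G^1_\tau,\tau_q)\to(G/G^1_\tau,\tau_q)$ be the continuous endomorphism induced by $\phi$. Then $$\mathrm{ent}^\star_\tau(\phi)=\mathrm{ent}^\star_{\tau_q}(\phi^1_\tau).$$
   Context: Topological groups are not assumed Hausdorff. For an abelian group $G$, let $\mathcal C(G)$ be the family of all finite-index subgroups of $G$. For an endomorphism $\phi$ of $G$, $N\in\mathcal C(G)$ and an integer $n\ge 1$, let $B_n(\phi,N)=N\cap\phi^{-1}(N)\cap\ldots\cap\phi^{-n+1}(N)$, $C_n(\phi,N)=G/B_n(\phi,N)$ (a finite group), and $H^\star(\phi,N)=\lim_{n\to\infty}\frac{\log|C_n(\phi,N)|}{n}$ (the limit exists and is finite). For a topological abelian group $(G,\tau)$ let $\mathcal C_\tau(G)=\{N\in\mathcal C(G): N \text{ is } \tau\text{-open}\}$. The topological adjoint entropy of a continuous endomorphism $\phi:(G,\tau)\to(G,\tau)$ is $\mathrm{ent}^\star_\tau(\phi)=\sup\{H^\star(\phi,N):N\in\mathcal C_\tau(G)\}\in[0,\infty]$. *)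

theory Defs
  imports "HOL-Analysis.Analysis" "HOL-Algebra.Coset"
begin

section \<open>Topological abelian groups\<close>

text \<open>No separation axiom is imposed.\<close>

locale topological_comm_group = comm_group G
  for G :: "('a, 'b) monoid_scheme" (structure) and T :: "'a topology" +
  assumes topspace_eq: "topspace T = carrier G"
    and continuous_mult: "continuous_map (prod_topology T T) T (\<lambda>(x, y). x \<otimes> y)"
    and continuous_inv: "continuous_map T T (\<lambda>x. inv x)"

section \<open>Topological adjoint entropy\<close>

definition finite_index_subgroups :: "('a, 'b) monoid_scheme \<Rightarrow> 'a set set"
  where "finite_index_subgroups G = {N. subgroup N G \<and> finite (rcosets\<^bsub>G\<^esub> N)}"

definition open_finite_index_subgroups ::
    "('a, 'b) monoid_scheme \<Rightarrow> 'a topology \<Rightarrow> 'a set set"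
  where "open_finite_index_subgroups G T = {N \<in> finite_index_subgroups G. openin T N}"

text \<open>
  The intersection of the preimages of \<open>N\<close> under \<open>\<phi>\<^sup>0, \<dots>, \<phi>\<^sup>n\<^sup>-\<^sup>1\<close>.
  Preimages are taken inside the carrier; outside of it \<open>\<phi>\<close> is arbitrary.
\<close>

definition cotrajectory ::
    "('a, 'b) monoid_scheme \<Rightarrow> ('a \<Rightarrow> 'a) \<Rightarrow> 'a set \<Rightarrow> nat \<Rightarrow> 'a set"
  where "cotrajectory G \<phi> N n = {x \<in> carrier G. \<forall>i<n. (\<phi> ^^ i) x \<in> N}"

definition adjoint_entropy_wrt ::
    "('a, 'b) monoid_scheme \<Rightarrow> ('a \<Rightarrow> 'a) \<Rightarrow> 'a set \<Rightarrow> real"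
  where "adjoint_entropy_wrt G \<phi> N =
    lim (\<lambda>n. ln (real (order (G Mod cotrajectory G \<phi> N n))) / real n)"

text \<open>
  The supremum is over a nonempty family, since \<open>carrier G\<close> is always open and of index one;
  so the value in \<^typ>\<open>ereal\<close> is the supremum in \<open>[0, \<infinity>]\<close>.
\<close>

definition top_adjoint_entropy ::
    "('a, 'b) monoid_scheme \<Rightarrow> 'a topology \<Rightarrow> ('a \<Rightarrow> 'a) \<Rightarrow> ereal"
  where "top_adjoint_entropy G T \<phi> =
    (SUP N \<in> open_finite_index_subgroups G T. ereal (adjoint_entropy_wrt G \<phi> N))"

section \<open>Quotients\<close>

definition open_finite_index_core :: "('a, 'b) monoid_scheme \<Rightarrow> 'a topology \<Rightarrow> 'a set"
  where "open_finite_index_core G T = \<Inter> (open_finite_index_subgroups G T)"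

text \<open>The finest topology on \<open>p ` topspace T\<close> that makes \<open>p\<close> continuous.\<close>

definition quotient_topology :: "'a topology \<Rightarrow> ('a \<Rightarrow> 'c) \<Rightarrow> 'c topology"
  where "quotient_topology T p =
    topology (\<lambda>U. U \<subseteq> p ` topspace T \<and> openin T {x \<in> topspace T. p x \<in> U})"

definition coset_topology ::
    "('a, 'b) monoid_scheme \<Rightarrow> 'a topology \<Rightarrow> 'a set \<Rightarrow> 'a set topology"
  where "coset_topology G T H = quotient_topology T (\<lambda>x. H #>\<^bsub>G\<^esub> x)"

text \<open>
  On a coset \<open>X\<close> the map \<open>x \<mapsto> H #> \<phi> x\<close> is constant when \<open>\<phi>\<close> maps \<open>H\<close> into itself;
  the induced map takes this common value, see \<open>induced_map_coset\<close> below.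
\<close>

definition induced_map ::
    "('a, 'b) monoid_scheme \<Rightarrow> 'a set \<Rightarrow> ('a \<Rightarrow> 'a) \<Rightarrow> 'a set \<Rightarrow> 'a set"
  where "induced_map G H \<phi> = (\<lambda>X. the_elem ((\<lambda>x. H #>\<^bsub>G\<^esub> \<phi> x) ` X))"

section \<open>Well-definedness\<close>

lemma openin_quotient_topology:
  "openin (quotient_topology T p) U \<longleftrightarrow>
    U \<subseteq> p ` topspace T \<and> openin T {x \<in> topspace T. p x \<in> U}"
proof -
  have "istopology (\<lambda>U. U \<subseteq> p ` topspace T \<and> openin T {x \<in> topspace T. p x \<in> U})"
    unfolding istopology_def
  proof (intro conjI allI impI)
    fix S U
    assume S: "S \<subseteq> p ` topspace T \<and> openin T {x \<in> topspace T. p x \<in> S}"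
      and U: "U \<subseteq> p ` topspace T \<and> openin T {x \<in> topspace T. p x \<in> U}"
    have "{x \<in> topspace T. p x \<in> S \<inter> U} =
        {x \<in> topspace T. p x \<in> S} \<inter> {x \<in> topspace T. p x \<in> U}"
      by blast
    then show "openin T {x \<in> topspace T. p x \<in> S \<inter> U}"
      using S U by auto
    show "S \<inter> U \<subseteq> p ` topspace T"
      using S by blast
  next
    fix K
    assume K: "\<forall>S\<in>K. S \<subseteq> p ` topspace T \<and> openin T {x \<in> topspace T. p x \<in> S}"
    have "{x \<in> topspace T. p x \<in> \<Union> K} = (\<Union>S\<in>K. {x \<in> topspace T. p x \<in> S})"
      by blast
    then show "openin T {x \<in> topspace T. p x \<in> \<Union> K}"
      using K by auto
    show "\<Union> K \<subseteq> p ` topspace T"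
      using K by blast
  qed
  then show ?thesis
    by (simp add: quotient_topology_def topology_inverse')
qed

lemma topspace_quotient_topology [simp]:
  "topspace (quotient_topology T p) = p ` topspace T"
proof (rule antisym)
  show "topspace (quotient_topology T p) \<subseteq> p ` topspace T"
    using openin_quotient_topology openin_topspace by metis
  have "{x \<in> topspace T. p x \<in> p ` topspace T} = topspace T"
    by blast
  then have "openin (quotient_topology T p) (p ` topspace T)"
    by (simp add: openin_quotient_topology)
  then show "p ` topspace T \<subseteq> topspace (quotient_topology T p)"
    by (rule openin_subset)
qed

lemma quotient_map_quotient_topology: "quotient_map T (quotient_topology T p) p"
  by (auto simp: quotient_map_def openin_quotient_topology)

context topological_comm_group
begin

lemma carrier_in_open_finite_index:
  "carrier G \<in> open_finite_index_subgroups G T"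
proof -
  have "rcosets (carrier G) \<subseteq> {carrier G}"
    using coset_join2 subgroup_self by (auto simp: RCOSETS_def)
  then have "finite (rcosets (carrier G))"
    using finite_subset by blast
  then show ?thesis
    using openin_topspace[of T]
    by (simp add: open_finite_index_subgroups_def finite_index_subgroups_def
        subgroup_self topspace_eq)
qed

lemma subgroup_core: "subgroup (open_finite_index_core G T) G"
  unfolding open_finite_index_core_def
  using carrier_in_open_finite_index
  by (intro subgroups_Inter)
    (auto simp: open_finite_index_subgroups_def finite_index_subgroups_def)

lemma preimage_open_finite_index:
  assumes hom: "\<phi> \<in> hom G G" and cont: "continuous_map T T \<phi>"
    and N: "N \<in> open_finite_index_subgroups G T"
  shows "{x \<in> carrier G. \<phi> x \<in> N} \<in> open_finite_index_subgroups G T"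
proof -
  let ?M = "{x \<in> carrier G. \<phi> x \<in> N}"
  interpret \<phi>: group_hom G G \<phi>
    using hom by unfold_locales
  have sN: "subgroup N G" and fN: "finite (rcosets N)" and oN: "openin T N"
    using N by (auto simp: open_finite_index_subgroups_def finite_index_subgroups_def)
  interpret N: subgroup N G by (rule sN)
  have sM: "subgroup ?M G"
  proof (rule subgroupI)
    show "?M \<subseteq> carrier G"
      by blast
  next
    have "\<one> \<in> ?M"
      using N.one_closed by simp
    then show "?M \<noteq> {}"
      by blast
  next
    fix a assume "a \<in> ?M"
    then show "inv a \<in> ?M"
      using N.m_inv_closed by simp
  next
    fix a b assume "a \<in> ?M" "b \<in> ?M"
    then show "a \<otimes> b \<in> ?M"
      using N.m_closed by simp
  qed
  have oM: "openin T ?M"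
    using cont oN by (simp add: continuous_map_def topspace_eq)
  have "inj_on (\<lambda>X. N #> \<phi> (SOME x. x \<in> X)) (rcosets ?M)"
  proof (rule inj_onI)
    fix X Y
    assume X: "X \<in> rcosets ?M" and Y: "Y \<in> rcosets ?M"
      and eq: "N #> \<phi> (SOME x. x \<in> X) = N #> \<phi> (SOME x. x \<in> Y)"
    define x where "x = (SOME x. x \<in> X)"
    define y where "y = (SOME x. x \<in> Y)"
    have x: "x \<in> X" and y: "y \<in> Y"
      unfolding x_def y_def using X Y subgroup.rcosets_non_empty[OF sM] by (auto simp: some_in_eq)
    have xc: "x \<in> carrier G" and yc: "y \<in> carrier G"
      using x y X Y subgroup.rcosets_carrier[OF sM is_group] by auto
    have XM: "X = ?M #> x" and YM: "Y = ?M #> y"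
      using X Y x y repr_independence[OF _ _ sM] by (auto simp: RCOSETS_def)
    have "\<phi> x \<in> N #> \<phi> y"
      using eq rcos_self[OF _ sN] xc by (metis x_def y_def \<phi>.hom_closed)
    then have "\<phi> x \<otimes> inv \<phi> y \<in> N"
      using N.rcos_module_imp[OF is_group] yc by simp
    then have "x \<otimes> inv y \<in> ?M"
      using xc yc by simp
    then have "x \<in> ?M #> y"
      using subgroup.rcos_module_rev[OF sM is_group] xc yc by blast
    then show "X = Y"
      using XM YM repr_independence[OF _ yc sM] by simp
  qed
  moreover have "(\<lambda>X. N #> \<phi> (SOME x. x \<in> X)) ` (rcosets ?M) \<subseteq> rcosets N"
  proof (clarify)
    fix X assume X: "X \<in> rcosets ?M"
    then have "(SOME x. x \<in> X) \<in> X"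
      using subgroup.rcosets_non_empty[OF sM] by (auto simp: some_in_eq)
    then have "(SOME x. x \<in> X) \<in> carrier G"
      using subgroup.rcosets_carrier[OF sM is_group X] by blast
    then show "N #> \<phi> (SOME x. x \<in> X) \<in> rcosets N"
      by (intro rcosetsI N.subset \<phi>.hom_closed)
  qed
  ultimately have "finite (rcosets ?M)"
    using fN inj_on_finite by blast
  then show ?thesis
    using sM oM by (simp add: open_finite_index_subgroups_def finite_index_subgroups_def)
qed

lemma core_invariant:
  assumes "\<phi> \<in> hom G G" "continuous_map T T \<phi>"
  shows "\<phi> ` open_finite_index_core G T \<subseteq> open_finite_index_core G T"
  using preimage_open_finite_index[OF assms]
  unfolding open_finite_index_core_def by blast

lemma induced_map_coset:
  assumes hom: "\<phi> \<in> hom G G" and H: "subgroup H G" and inv: "\<phi> ` H \<subseteq> H"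
    and x: "x \<in> carrier G"
  shows "induced_map G H \<phi> (H #> x) = H #> \<phi> x"
proof -
  interpret \<phi>: group_hom G G \<phi>
    using hom by unfold_locales
  interpret H: subgroup H G by (rule H)
  have const: "H #> \<phi> y = H #> \<phi> x" if "y \<in> H #> x" for y
  proof -
    obtain h where h: "h \<in> H" "y = h \<otimes> x"
      using \<open>y \<in> H #> x\<close> by (auto simp: r_coset_def)
    then have "\<phi> y = \<phi> h \<otimes> \<phi> x"
      using x by simp
    moreover have "\<phi> h \<in> H"
      using inv h by blast
    ultimately have "\<phi> y \<in> H #> \<phi> x"
      by (auto simp: r_coset_def)
    then show ?thesis
      using repr_independence[OF _ _ H] x by simp
  qed
  then have "(\<lambda>y. H #> \<phi> y) ` (H #> x) = {H #> \<phi> x}"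
    using rcos_self[OF x H] by blast
  then show ?thesis
    by (simp add: induced_map_def)
qed

lemma induced_map_hom:
  assumes hom: "\<phi> \<in> hom G G" and H: "subgroup H G" and inv: "\<phi> ` H \<subseteq> H"
  shows "induced_map G H \<phi> \<in> hom (G Mod H) (G Mod H)"
proof -
  interpret \<phi>: group_hom G G \<phi>
    using hom by unfold_locales
  interpret H: normal H G
    using H by (rule subgroup_imp_normal)
  show ?thesis
    by (auto simp: hom_def carrier_FactGroup induced_map_coset[OF assms] H.rcos_sum)
qed

lemma topspace_coset_topology:
  "topspace (coset_topology G T H) = carrier (G Mod H)"
  by (simp add: coset_topology_def carrier_FactGroup topspace_eq)

lemma continuous_map_induced_map:
  assumes hom: "\<phi> \<in> hom G G" and H: "subgroup H G" and inv: "\<phi> ` H \<subseteq> H"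
    and cont: "continuous_map T T \<phi>"
  shows "continuous_map (coset_topology G T H) (coset_topology G T H) (induced_map G H \<phi>)"
proof -
  have q: "quotient_map T (coset_topology G T H) (\<lambda>x. H #> x)"
    by (simp add: coset_topology_def quotient_map_quotient_topology)
  have "continuous_map T (coset_topology G T H) ((\<lambda>x. H #> x) \<circ> \<phi>)"
    using continuous_map_compose[OF cont quotient_imp_continuous_map[OF q]] .
  then have "continuous_map T (coset_topology G T H) (induced_map G H \<phi> \<circ> (\<lambda>x. H #> x))"
    by (rule continuous_map_eq) (simp add: induced_map_coset[OF hom H inv] topspace_eq)
  then show ?thesis
    by (rule continuous_compose_quotient_map[OF q])
qed

lemma open_map_coset:
  assumes H: "subgroup H G"
  shows "open_map T (coset_topology G T H) (\<lambda>x. H #> x)"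
  unfolding open_map_def
proof (intro allI impI)
  fix U assume U: "openin T U"
  interpret H: subgroup H G by (rule H)
  have Uc: "U \<subseteq> carrier G"
    using openin_subset[OF U] by (simp add: topspace_eq)
  have opn: "openin T {x \<in> carrier G. h \<otimes> x \<in> U}" if "h \<in> H" for h
  proof -
    have "continuous_map T (prod_topology T T) (\<lambda>x. (h, x))"
      using that by (simp add: continuous_map_pairedI topspace_eq)
    from continuous_map_compose[OF this continuous_mult]
    have "continuous_map T T (\<lambda>x. h \<otimes> x)"
      by (simp add: o_def)
    then show ?thesis
      using U by (simp add: continuous_map_def topspace_eq)
  qed
  have "{x \<in> carrier G. H #> x \<in> (\<lambda>x. H #> x) ` U} = (\<Union>h\<in>H. {x \<in> carrier G. h \<otimes> x \<in> U})"
  proof (intro equalityI subsetI)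
    fix x assume "x \<in> {x \<in> carrier G. H #> x \<in> (\<lambda>x. H #> x) ` U}"
    then obtain u where "x \<in> carrier G" "u \<in> U" "H #> x = H #> u"
      by blast
    moreover have "u \<in> H #> u"
      using rcos_self[OF _ H, of u] \<open>u \<in> U\<close> Uc by blast
    ultimately have "u \<in> H #> x"
      by simp
    then show "x \<in> (\<Union>h\<in>H. {x \<in> carrier G. h \<otimes> x \<in> U})"
      using \<open>x \<in> carrier G\<close> \<open>u \<in> U\<close> by (auto simp: r_coset_def)
  next
    fix x assume "x \<in> (\<Union>h\<in>H. {x \<in> carrier G. h \<otimes> x \<in> U})"
    then obtain h where x: "x \<in> carrier G" and h: "h \<in> H" "h \<otimes> x \<in> U"
      by blast
    have "h \<otimes> x \<in> H #> x"
      using h by (auto simp: r_coset_def)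
    then have "H #> x = H #> (h \<otimes> x)"
      using repr_independence[OF _ x H] by blast
    then show "x \<in> {x \<in> carrier G. H #> x \<in> (\<lambda>x. H #> x) ` U}"
      using x h by blast
  qed
  then show "openin (coset_topology G T H) ((\<lambda>x. H #> x) ` U)"
    using opn Uc by (auto simp: coset_topology_def openin_quotient_topology topspace_eq)
qed

lemma topological_comm_group_quotient:
  assumes H: "subgroup H G"
  shows "topological_comm_group (G Mod H) (coset_topology G T H)"
proof -
  let ?Q = "coset_topology G T H" and ?p = "\<lambda>x. H #> x"
  interpret H: normal H G
    using H by (rule subgroup_imp_normal)
  interpret Q: comm_group "G Mod H"
    using H by (rule abelian_FactGroup)
  have q: "quotient_map T ?Q ?p"
    by (simp add: coset_topology_def quotient_map_quotient_topology)
  have p: "continuous_map T ?Q ?p"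
    using q by (rule quotient_imp_continuous_map)
  let ?pp = "\<lambda>(x, y). (?p x, ?p y)"
  have pp_cont: "continuous_map (prod_topology T T) (prod_topology ?Q ?Q) ?pp"
    using p by (simp add: continuous_map_prod_top)
  have pp_surj: "?pp ` topspace (prod_topology T T) = topspace (prod_topology ?Q ?Q)"
    by (auto simp: topspace_coset_topology carrier_FactGroup topspace_eq image_iff)
  have pp_open: "open_map (prod_topology T T) (prod_topology ?Q ?Q) ?pp"
    unfolding open_map_def
  proof (intro allI impI)
    fix W assume W: "openin (prod_topology T T) W"
    show "openin (prod_topology ?Q ?Q) (?pp ` W)"
      unfolding openin_prod_topology_alt
    proof (intro allI impI)
      fix a b assume "(a, b) \<in> ?pp ` W"
      then obtain x y where xy: "(x, y) \<in> W" "a = ?p x" "b = ?p y"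
        by auto
      then obtain U V where UV: "openin T U" "openin T V" "x \<in> U" "y \<in> V" "U \<times> V \<subseteq> W"
        using W unfolding openin_prod_topology_alt by meson
      have "openin ?Q (?p ` U)" "openin ?Q (?p ` V)"
        using open_map_coset[OF H] UV by (auto simp: open_map_def)
      moreover have "?p ` U \<times> ?p ` V \<subseteq> ?pp ` W"
        using UV(5) by force
      ultimately show "\<exists>U V. openin ?Q U \<and> openin ?Q V \<and> a \<in> U \<and> b \<in> V \<and> U \<times> V \<subseteq> ?pp ` W"
        using xy UV by blast
    qed
  qed
  have qq: "quotient_map (prod_topology T T) (prod_topology ?Q ?Q) ?pp"
    using continuous_open_quotient_map[OF pp_cont pp_open] pp_surj by blast
  have mult: "continuous_map (prod_topology ?Q ?Q) ?Q (\<lambda>(X, Y). X \<otimes>\<^bsub>G Mod H\<^esub> Y)"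
  proof (rule continuous_compose_quotient_map[OF qq])
    show "continuous_map (prod_topology T T) ?Q ((\<lambda>(X, Y). X \<otimes>\<^bsub>G Mod H\<^esub> Y) \<circ> ?pp)"
      by (rule continuous_map_eq[OF continuous_map_compose[OF continuous_mult p]])
        (auto simp: topspace_eq H.rcos_sum)
  qed
  have minv: "continuous_map ?Q ?Q (\<lambda>X. inv\<^bsub>G Mod H\<^esub> X)"
  proof (rule continuous_compose_quotient_map[OF q])
    show "continuous_map T ?Q ((\<lambda>X. inv\<^bsub>G Mod H\<^esub> X) \<circ> ?p)"
      by (rule continuous_map_eq[OF continuous_map_compose[OF continuous_inv p]])
        (auto simp: topspace_eq carrier_FactGroup H.inv_FactGroup H.rcos_inv)
  qed
  show ?thesis
    by unfold_locales (use topspace_coset_topology mult minv in auto)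
qed

end

end

theory Submission
  imports Defs
begin

text \<open>
  Every open finite-index subgroup contains \<open>G1\<close>, so taking preimages under the projection
  \<open>G \<rightarrow> G / G1\<close> identifies the two families of subgroups. The projection intertwines
  \<open>\<phi>\<close> with the induced map, so this correspondence respects cotrajectories, and it preserves
  indices.
\<close>

text \<open>Both sides say that \<open>h (x \<otimes> inv g)\<close> lies in \<open>B\<close>.
  Allowing \<open>B\<close> to be any subset lets the index computations below apply directly to
  cotrajectories.\<close>

lemma (in group_hom) preimage_r_coset:
  assumes "B \<subseteq> carrier H" and g: "g \<in> carrier G"
  shows "{x \<in> carrier G. h x \<in> B #>\<^bsub>H\<^esub> h g} = {x \<in> carrier G. h x \<in> B} #> g"
proof (intro equalityI subsetI)
  fix x assume "x \<in> {x \<in> carrier G. h x \<in> B #>\<^bsub>H\<^esub> h g}"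
  then obtain b where x: "x \<in> carrier G" and b: "b \<in> B" "h x = b \<otimes>\<^bsub>H\<^esub> h g"
    by (auto simp: r_coset_def)
  then have "h (x \<otimes> inv g) = b"
    using assms by (auto simp: H.m_assoc)
  moreover have "x = (x \<otimes> inv g) \<otimes> g"
    using x g by (simp add: G.m_assoc)
  ultimately have "x \<otimes> inv g \<in> {x \<in> carrier G. h x \<in> B}" "x = (x \<otimes> inv g) \<otimes> g"
    using x g b(1) by simp_all
  then show "x \<in> {x \<in> carrier G. h x \<in> B} #> g"
    by (auto simp only: r_coset_def)
qed (use g in \<open>auto simp: r_coset_def\<close>)

text \<open>Surjectivity enters twice: a subset of the image is determined by its preimage, and each
  coset of \<open>B\<close> has a representative \<open>h g\<close>, so
  \<open>preimage_r_coset\<close> identifies its preimage.\<close>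

lemma (in group_hom) bij_betw_rcosets_preimage:
  assumes surj: "h ` carrier G = carrier H" and B: "B \<subseteq> carrier H"
  shows "bij_betw (\<lambda>X. {x \<in> carrier G. h x \<in> X}) (rcosets\<^bsub>H\<^esub> B)
    (rcosets {x \<in> carrier G. h x \<in> B})"
  unfolding bij_betw_def
proof
  show "inj_on (\<lambda>X. {x \<in> carrier G. h x \<in> X}) (rcosets\<^bsub>H\<^esub> B)"
  proof (rule inj_onI)
    fix X Y assume "X \<in> rcosets\<^bsub>H\<^esub> B" "Y \<in> rcosets\<^bsub>H\<^esub> B"
    then have "X \<subseteq> h ` carrier G" "Y \<subseteq> h ` carrier G"
      using B H.r_coset_subset_G by (auto simp: surj RCOSETS_def)
    moreover assume "{x \<in> carrier G. h x \<in> X} = {x \<in> carrier G. h x \<in> Y}"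
    ultimately show "X = Y"
      by blast
  qed
  have "rcosets\<^bsub>H\<^esub> B = (\<lambda>g. B #>\<^bsub>H\<^esub> h g) ` carrier G"
    by (auto simp: RCOSETS_def simp flip: surj)
  then show "(\<lambda>X. {x \<in> carrier G. h x \<in> X}) ` (rcosets\<^bsub>H\<^esub> B) =
      rcosets {x \<in> carrier G. h x \<in> B}"
    by (auto simp: RCOSETS_def image_image preimage_r_coset[OF B])
qed

lemma (in group_hom) order_Mod_preimage:
  assumes "h ` carrier G = carrier H" "B \<subseteq> carrier H"
  shows "order (G Mod {x \<in> carrier G. h x \<in> B}) = order (H Mod B)"
  using bij_betw_same_card[OF bij_betw_rcosets_preimage[OF assms]]
  by (simp add: order_def FactGroup_def)

lemma (in group_hom) subgroup_preimage:
  assumes "subgroup B H"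
  shows "subgroup {x \<in> carrier G. h x \<in> B} G"
proof -
  interpret B: subgroup B H by (rule assms)
  show ?thesis
    by (rule G.subgroupI) (use B.one_closed hom_one in auto)
qed

lemma (in group_hom) finite_index_subgroups_preimage_iff:
  assumes "h ` carrier G = carrier H" "subgroup B H"
  shows "{x \<in> carrier G. h x \<in> B} \<in> finite_index_subgroups G \<longleftrightarrow>
    B \<in> finite_index_subgroups H"
  using bij_betw_finite[OF bij_betw_rcosets_preimage[OF assms(1)
    subgroup.subset[OF assms(2)]]] subgroup_preimage assms(2)
  by (simp add: finite_index_subgroups_def)

lemma (in normal) group_hom_r_coset: "group_hom G (G Mod H) (\<lambda>x. H #> x)"
  using r_coset_hom_Mod factorgroup_is_group is_group
  by (simp add: group_hom_def group_hom_axioms_def)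

text \<open>Membership in \<open>A\<close> is carried through the induction because \<open>g\<close>
  and \<open>f\<close> are intertwined by \<open>p\<close> only on \<open>A\<close>.\<close>

lemma funpow_semiconj_on:
  assumes "\<And>x. x \<in> A \<Longrightarrow> f x \<in> A" "\<And>x. x \<in> A \<Longrightarrow> g (p x) = p (f x)" "x \<in> A"
  shows "(f ^^ i) x \<in> A \<and> (g ^^ i) (p x) = p ((f ^^ i) x)"
  using assms by (induction i) auto

context topological_comm_group
begin

text \<open>The correspondence theorem restricted to open subgroups of finite index; the preimage
  map is inverted by taking images under the projection.\<close>

lemma open_finite_index_subgroups_quotient:
  assumes H: "subgroup H G"
  shows "(\<lambda>M. {x \<in> carrier G. H #> x \<in> M}) `
      open_finite_index_subgroups (G Mod H) (coset_topology G T H) =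
    {N \<in> open_finite_index_subgroups G T. H \<subseteq> N}"
    (is "?pre ` ?Q = ?R")
proof (intro equalityI subsetI)
  let ?p = "\<lambda>x. H #> x"
  interpret H: normal H G
    using H by (rule subgroup_imp_normal)
  interpret p: group_hom G "G Mod H" ?p
    by (rule H.group_hom_r_coset)
  have surj: "?p ` carrier G = carrier (G Mod H)"
    by (simp add: carrier_FactGroup)
  have op: "openin (coset_topology G T H) M \<longleftrightarrow> openin T (?pre M)"
    if "M \<subseteq> carrier (G Mod H)" for M
    using that by (simp add: coset_topology_def openin_quotient_topology topspace_eq surj)
  \<comment> \<open>Index is preserved by the coset bijection, openness by the definition of the
    quotient topology. Each inclusion uses one direction of this equivalence.\<close>
  have iff: "?pre M \<in> open_finite_index_subgroups G T \<longleftrightarrow> M \<in> ?Q"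
    if "subgroup M (G Mod H)" for M
    using p.finite_index_subgroups_preimage_iff[OF surj that] op[OF subgroup.subset[OF that]]
    by (simp add: open_finite_index_subgroups_def)
  {
    fix N assume "N \<in> ?pre ` ?Q"
    then obtain M where M: "M \<in> ?Q" "N = ?pre M" "subgroup M (G Mod H)"
      by (auto simp: open_finite_index_subgroups_def finite_index_subgroups_def)
    \<comment> \<open>\<open>H\<close> is the identity of \<open>G Mod H\<close>, and every element
      of \<open>H\<close> projects to it.\<close>
    have "H \<in> M"
      using subgroup.one_closed[OF M(3)] by simp
    then have "H \<subseteq> N"
      using M(2) by (auto simp: H.rcos_const)
    then show "N \<in> ?R"
      using M iff by blast
  next
    fix N assume N: "N \<in> ?R"
    then have sN: "subgroup N G"
      by (simp add: open_finite_index_subgroups_def finite_index_subgroups_def)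
    interpret N: subgroup N G by (rule sN)
    \<comment> \<open>\<open>N\<close> is saturated: if \<open>x\<close> lies in
      \<open>H #> y\<close> with \<open>y\<close> in \<open>N\<close>, then \<open>x\<close> is a
      product of elements of \<open>N\<close>, since \<open>H \<subseteq> N\<close>.\<close>
    have pre: "?pre (?p ` N) = N"
    proof (intro equalityI subsetI)
      fix x assume "x \<in> ?pre (?p ` N)"
      then obtain y where "x \<in> carrier G" "y \<in> N" "x \<in> H #> y"
        using rcos_self[OF _ H] by blast
      then show "x \<in> N"
        using N by (auto simp: r_coset_def)
    qed auto
    have "?p ` N \<in> ?Q"
      using iff[OF p.subgroup_img_is_subgroup[OF sN]] N by (simp only: pre) simp
    then have "?pre (?p ` N) \<in> ?pre ` ?Q"
      by (rule imageI)
    then show "N \<in> ?pre ` ?Q"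
      by (simp only: pre)
  }
qed

text \<open>For every \<open>n\<close> the cotrajectory of the preimage is the preimage of the
  cotrajectory, so both have the same index. The two sequences agree term by term, hence so do their
  values under \<open>lim\<close>, with no convergence argument.\<close>

lemma adjoint_entropy_wrt_quotient:
  assumes hom: "\<phi> \<in> hom G G" and H: "subgroup H G" and inv: "\<phi> ` H \<subseteq> H"
  shows "adjoint_entropy_wrt G \<phi> {x \<in> carrier G. H #> x \<in> M} =
    adjoint_entropy_wrt (G Mod H) (induced_map G H \<phi>) M"
proof -
  let ?p = "\<lambda>x. H #> x"
  interpret H: normal H G
    using H by (rule subgroup_imp_normal)
  interpret p: group_hom G "G Mod H" ?p
    by (rule H.group_hom_r_coset)
  have iter: "(\<phi> ^^ i) x \<in> carrier G \<and>
      (induced_map G H \<phi> ^^ i) (?p x) = ?p ((\<phi> ^^ i) x)" if "x \<in> carrier G" for i x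
    by (rule funpow_semiconj_on)
      (use that hom induced_map_coset[OF hom H inv] in \<open>auto simp: hom_def\<close>)
  have "cotrajectory G \<phi> {x \<in> carrier G. ?p x \<in> M} n =
      {x \<in> carrier G. ?p x \<in> cotrajectory (G Mod H) (induced_map G H \<phi>) M n}" for n
    using iter by (auto simp: cotrajectory_def carrier_FactGroup)
  moreover have "order (G Mod {x \<in> carrier G. ?p x \<in> B}) = order (G Mod H Mod B)"
    if "B \<subseteq> carrier (G Mod H)" for B
    using that by (intro p.order_Mod_preimage) (simp_all add: carrier_FactGroup)
  moreover have "cotrajectory (G Mod H) (induced_map G H \<phi>) M n \<subseteq> carrier (G Mod H)" for n
    by (auto simp: cotrajectory_def)
  ultimately show ?thesis
    by (simp add: adjoint_entropy_wrt_def)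
qed

end

theorem proposition4p11:
  fixes G :: "('a, 'b) monoid_scheme" and T :: "'a topology" and \<phi> :: "'a \<Rightarrow> 'a"
  assumes "topological_comm_group G T"
    and "\<phi> \<in> hom G G"
    and "continuous_map T T \<phi>"
  defines "G1 \<equiv> open_finite_index_core G T"
  shows "top_adjoint_entropy G T \<phi> =
    top_adjoint_entropy (G Mod G1) (coset_topology G T G1) (induced_map G G1 \<phi>)"
proof -
  interpret topological_comm_group G T by (rule assms(1))
  have G1: "subgroup G1 G" and inv: "\<phi> ` G1 \<subseteq> G1"
    unfolding G1_def using subgroup_core core_invariant[OF assms(2,3)] by auto
  \<comment> \<open>\<open>G1\<close> is the intersection of this family, so each member contains
    it.\<close>
  have "open_finite_index_subgroups G T = {N \<in> open_finite_index_subgroups G T. G1 \<subseteq> N}"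
    by (auto simp: G1_def open_finite_index_core_def)
  also have "\<dots> = (\<lambda>M. {x \<in> carrier G. G1 #>\<^bsub>G\<^esub> x \<in> M}) `
      open_finite_index_subgroups (G Mod G1) (coset_topology G T G1)"
    using open_finite_index_subgroups_quotient[OF G1] by simp
  \<comment> \<open>The family of \<open>G\<close> is now an image of the family of the quotient, so
    both suprema range over the same set of values.\<close>
  finally show ?thesis
    by (simp add: top_adjoint_entropy_def image_image
        adjoint_entropy_wrt_quotient[OF assms(2) G1 inv])
qed

end
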